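(* Let $\Omega\subset\mathbb{R}^d$ be a bounded domain. For $n\in\mathbb{N}$ let $M_n\subset L^2_\circ(\Omega)$ and $X_n\subset H^1_0(\Omega)^d$ be closed subspaces, and let $$\beta_n=\inf_{q\in M_n}\ \sup_{\mathbf v\in X_n}\ \frac{\langle \operatorname{div}\mathbf v,q\rangle_\Omega}{|\mathbf v|_{1,\Omega}\,\|q\|_{0,\Omega}} .$$ Assume that the sequence $(M_n)$ is asymptotically dense in the sense that for every $q\in L^2_\circ(\Omega)$ there exists a sequence $(q_n)_{n\in\mathbb{N}}$ with $q_n\in M_n$ converging to $q$ in $L^2(\Omega)$. Then $$\limsup_{n\to\infty}\beta_n\le\beta(\Omega).$$
   Context: A domain is a nonempty connected open set. $L^2_\circ(\Omega)$ is the space of functions in $L^2(\Omega)$ with mean value zero; $\langle\cdot,\cdot\rangle_\Omega$ and $\|\cdot\|_{0,\Omega}$ are the $L^2(\Omega)$ scalar product and norm. $H^1_0(\Omega)$ is the closure of the smooth functions with compact support in $\Omega$ with respect to the $H^1$ seminorm; for vector functions $|\mathbf v|_{1,\Omega}=\|\nabla\mathbf v\|_{0,\Omega}=\big(\sum_{k,j=1}^d\|\partial_{x_j}v_k\|_{0,\Omega}^2\big)^{1/2}$. The inf-sup (LBB) constant of $\Omega$ is $$\beta(\Omega)=\inf_{q\in L^2_\circ(\Omega)}\ \sup_{\mathbf v\in H^1_0(\Omega)^d}\frac{\langle \operatorname{div}\mathbf v,q\rangle_\Omega}{|\mathbf v|_{1,\Omega}\,\|q\|_{0,\Omega}} .$$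 Infima and suprema of quotients are over nonzero elements (the supremum is $0$ if the velocity space is trivial). *)

theory Defs
  imports "HOL-Analysis.Analysis"
begin

text \<open>
  Elements of \<open>L\<^sup>2(\<Omega>)\<close> and \<open>H\<^sup>1\<^sub>0(\<Omega>)\<close> are represented by functions on the whole space,
  of which only the values on \<open>\<Omega>\<close>, up to a null set, matter. Accordingly ``nonzero'' means
  ``not almost everywhere zero on \<open>\<Omega>\<close>''.
\<close>

definition domain :: "(real ^ 'd) set \<Rightarrow> bool" where
  "domain \<Omega> \<longleftrightarrow> \<Omega> \<noteq> {} \<and> connected \<Omega> \<and> open \<Omega>"

definition nonzero_on :: "(real ^ 'd) set \<Rightarrow> (real ^ 'd \<Rightarrow> 'b::zero) \<Rightarrow> bool" where
  "nonzero_on \<Omega> f \<longleftrightarrow> \<not> (AE x in lebesgue_on \<Omega>. f x = 0)"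


subsection \<open>The space \<open>L\<^sup>2\<close>\<close>

definition L2 :: "(real ^ 'd) set \<Rightarrow> (real ^ 'd \<Rightarrow> real) set" where
  "L2 \<Omega> = {f. f \<in> borel_measurable (lebesgue_on \<Omega>) \<and> integrable (lebesgue_on \<Omega>) (\<lambda>x. (f x)\<^sup>2)}"

definition L2_inner :: "(real ^ 'd) set \<Rightarrow> (real ^ 'd \<Rightarrow> real) \<Rightarrow> (real ^ 'd \<Rightarrow> real) \<Rightarrow> real" where
  "L2_inner \<Omega> f g = (LINT x|lebesgue_on \<Omega>. f x * g x)"

definition L2_norm :: "(real ^ 'd) set \<Rightarrow> (real ^ 'd \<Rightarrow> real) \<Rightarrow> real" where
  "L2_norm \<Omega> f = sqrt (L2_inner \<Omega> f f)"

definition L2_mean_zero :: "(real ^ 'd) set \<Rightarrow> (real ^ 'd \<Rightarrow> real) set" where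
  "L2_mean_zero \<Omega> = {f \<in> L2 \<Omega>. (LINT x|lebesgue_on \<Omega>. f x) = 0}"


subsection \<open>Test functions and weak derivatives\<close>

definition partial :: "'d \<Rightarrow> (real ^ 'd \<Rightarrow> real) \<Rightarrow> real ^ 'd \<Rightarrow> real" where
  "partial j f x = frechet_derivative f (at x) (axis j 1)"

text \<open>
  A function is smooth iff all its iterated partial derivatives are (totally) differentiable;
  the list \<open>js\<close> ranges over all multi-indices, the empty one included.
\<close>

definition smooth :: "(real ^ 'd \<Rightarrow> real) \<Rightarrow> bool" where
  "smooth f \<longleftrightarrow> (\<forall>js :: 'd list. \<forall>x. foldr partial js f differentiable (at x))"

definition test_functions :: "(real ^ 'd) set \<Rightarrow> (real ^ 'd \<Rightarrow> real) set" where
  "test_functions \<Omega> =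
     {\<phi>. smooth \<phi> \<and> compact (closure {x. \<phi> x \<noteq> 0}) \<and> closure {x. \<phi> x \<noteq> 0} \<subseteq> \<Omega>}"

definition is_weak_partial ::
    "(real ^ 'd) set \<Rightarrow> 'd \<Rightarrow> (real ^ 'd \<Rightarrow> real) \<Rightarrow> (real ^ 'd \<Rightarrow> real) \<Rightarrow> bool" where
  "is_weak_partial \<Omega> j u g \<longleftrightarrow>
     (\<forall>\<phi> \<in> test_functions \<Omega>. L2_inner \<Omega> u (partial j \<phi>) = - L2_inner \<Omega> g \<phi>)"

definition H1 :: "(real ^ 'd) set \<Rightarrow> (real ^ 'd \<Rightarrow> real) set" where
  "H1 \<Omega> = {u \<in> L2 \<Omega>. \<forall>j. \<exists>g \<in> L2 \<Omega>. is_weak_partial \<Omega> j u g}"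

text \<open>The weak partial derivative; it is determined by \<open>u\<close> up to a null set for \<open>u \<in> H1 \<Omega>\<close>.\<close>

definition weak_partial ::
    "(real ^ 'd) set \<Rightarrow> 'd \<Rightarrow> (real ^ 'd \<Rightarrow> real) \<Rightarrow> real ^ 'd \<Rightarrow> real" where
  "weak_partial \<Omega> j u = (SOME g. g \<in> L2 \<Omega> \<and> is_weak_partial \<Omega> j u g)"

definition H1_seminorm :: "(real ^ 'd) set \<Rightarrow> (real ^ 'd \<Rightarrow> real) \<Rightarrow> real" where
  "H1_seminorm \<Omega> u = sqrt (\<Sum>j\<in>UNIV. (L2_norm \<Omega> (weak_partial \<Omega> j u))\<^sup>2)"

text \<open>
  The closure of the test functions with respect to the \<open>H\<^sup>1\<close> seminorm. By the
  Poincar\'e--Friedrichs inequality on a bounded \<open>\<Omega>\<close>, a sequence of test functions that is Cauchy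
  in the seminorm is also Cauchy in \<open>L\<^sup>2\<close>; its limit is the common limit in both senses.
  Convergence in \<open>L\<^sup>2\<close> has to be required explicitly, because the seminorm
  alone does not see additive constants and would admit these into the closure.
\<close>

definition H10 :: "(real ^ 'd) set \<Rightarrow> (real ^ 'd \<Rightarrow> real) set" where
  "H10 \<Omega> = {u \<in> H1 \<Omega>. \<exists>\<phi> :: nat \<Rightarrow> real ^ 'd \<Rightarrow> real.
     (\<forall>n. \<phi> n \<in> test_functions \<Omega>) \<and>
     (\<lambda>n. H1_seminorm \<Omega> (\<lambda>x. \<phi> n x - u x)) \<longlonglongrightarrow> 0 \<and>
     (\<lambda>n. L2_norm \<Omega> (\<lambda>x. \<phi> n x - u x)) \<longlonglongrightarrow> 0}"


subsection \<open>Vector fields\<close>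

definition H10_vec :: "(real ^ 'd) set \<Rightarrow> (real ^ 'd \<Rightarrow> real ^ 'd) set" where
  "H10_vec \<Omega> = {v. \<forall>k. (\<lambda>x. v x $ k) \<in> H10 \<Omega>}"

definition H1_seminorm_vec :: "(real ^ 'd) set \<Rightarrow> (real ^ 'd \<Rightarrow> real ^ 'd) \<Rightarrow> real" where
  "H1_seminorm_vec \<Omega> v =
     sqrt (\<Sum>k\<in>UNIV. \<Sum>j\<in>UNIV. (L2_norm \<Omega> (weak_partial \<Omega> j (\<lambda>x. v x $ k)))\<^sup>2)"

definition divergence :: "(real ^ 'd) set \<Rightarrow> (real ^ 'd \<Rightarrow> real ^ 'd) \<Rightarrow> real ^ 'd \<Rightarrow> real" where
  "divergence \<Omega> v x = (\<Sum>j\<in>UNIV. weak_partial \<Omega> j (\<lambda>y. v y $ j) x)"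


subsection \<open>Closed subspaces\<close>

text \<open>
  \<open>M\<close> is a linear subspace of the function space \<open>V\<close> that is closed with respect to the (semi)norm
  \<open>N\<close>. Closedness forces \<open>M\<close> to contain, with a function, all its representatives in \<open>V\<close>.
\<close>

definition closed_subspace ::
    "('a \<Rightarrow> 'b::real_vector) set \<Rightarrow> (('a \<Rightarrow> 'b) \<Rightarrow> real) \<Rightarrow> ('a \<Rightarrow> 'b) set \<Rightarrow> bool" where
  "closed_subspace V N M \<longleftrightarrow>
     M \<subseteq> V \<and>
     (\<lambda>x. 0) \<in> M \<and>
     (\<forall>f\<in>M. \<forall>g\<in>M. (\<lambda>x. f x + g x) \<in> M) \<and>
     (\<forall>c. \<forall>f\<in>M. (\<lambda>x. c *\<^sub>R f x) \<in> M) \<and>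
     (\<forall>u f. (\<forall>k::nat. u k \<in> M) \<and> f \<in> V \<and> (\<lambda>k. N (\<lambda>x. u k x - f x)) \<longlonglongrightarrow> 0 \<longrightarrow> f \<in> M)"


subsection \<open>Inf-sup constants\<close>

text \<open>
  Extended reals are used because the infimum over an empty set of pressures is \<open>\<infinity>\<close>.
\<close>

definition infsup ::
    "(real ^ 'd) set \<Rightarrow> (real ^ 'd \<Rightarrow> real) set \<Rightarrow> (real ^ 'd \<Rightarrow> real ^ 'd) set \<Rightarrow> ereal" where
  "infsup \<Omega> M X =
     (INF q \<in> {q \<in> M. nonzero_on \<Omega> q}.
        if {v \<in> X. nonzero_on \<Omega> v} = {} then 0
        else SUP v \<in> {v \<in> X. nonzero_on \<Omega> v}.
          ereal (L2_inner \<Omega> (divergence \<Omega> v) q / (H1_seminorm_vec \<Omega> v * L2_norm \<Omega> q)))"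

definition LBB :: "(real ^ 'd) set \<Rightarrow> ereal" where
  "LBB \<Omega> = infsup \<Omega> (L2_mean_zero \<Omega>) (H10_vec \<Omega>)"

end

theory Submission
  imports Defs
begin

text \<open>
  For fixed \<open>q\<close>, approximate \<open>q\<close> by \<open>p\<^sub>n \<in> M\<^sub>n\<close>. Since the divergence is bounded by the
  \<open>H\<^sup>1\<close> seminorm, replacing \<open>q\<close> by \<open>p\<^sub>n\<close> changes the quotients by an amount that tends to zero
  uniformly in the velocity, and the supremum over \<open>X\<^sub>n\<close> is at most the one over \<open>H\<^sup>1\<^sub>0\<close>.
  If \<open>X\<^sub>n\<close> is trivial, its supremum is \<open>0\<close> by convention, and one needs that the supremum over a
  nontrivial \<open>H\<^sup>1\<^sub>0\<close> is nonnegative. This follows by passing from \<open>v\<close> to \<open>-v\<close>; as weak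
  derivatives are arbitrary choices, it relies on their uniqueness almost everywhere, that is, on
  the fundamental lemma of the calculus of variations. Its test functions are polynomials in
  functions built from \<open>exp (-1/t)\<close>: if \<open>0 \<le> b\<^sub>i \<le> 1\<close> is positive exactly on the box \<open>B\<^sub>i\<close>, then
  \<open>1 - (\<Prod>i<n. (1 - b\<^sub>i) ^ n)\<close> converges to the indicator function of \<open>\<Union>i. B\<^sub>i\<close>.
\<close>

subsection \<open>Smooth bump functions\<close>

text \<open>The polynomial in \<open>1 / t\<close> is carried along so that the family contains all
  derivatives of the classical flat function \<open>exp (- (1 / t))\<close>, which is the case
  \<open>p = 1\<close>.\<close>

definition flat :: "real poly \<Rightarrow> real \<Rightarrow> real" where
  "flat p t = (if t > 0 then poly p (1 / t) * exp (- (1 / t)) else 0)"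

lemma poly_exp_tendsto_0: "((\<lambda>x::real. poly p x * exp (- x)) \<longlongrightarrow> 0) at_top"
proof -
  have "((\<lambda>x. \<Sum>i\<le>degree p. coeff p i * (x ^ i / exp x)) \<longlongrightarrow> (\<Sum>i\<le>degree p. coeff p i * 0)) at_top"
    by (intro tendsto_intros tendsto_power_div_exp_0)
  then show ?thesis
    by (simp add: poly_altdef exp_minus divide_inverse sum_distrib_right mult.assoc)
qed

text \<open>The substitution \<open>x = 1 / t\<close> turns the limit from the right into the decay
  of a polynomial times \<open>exp (- x)\<close> at infinity.\<close>

lemma flat_tendsto_0: "(flat p \<longlongrightarrow> 0) (at 0)"
proof -
  have "((\<lambda>t. poly p (1 / t) * exp (- (1 / t))) \<longlongrightarrow> 0) (at_right 0)"
    unfolding filterlim_at_right_to_top using poly_exp_tendsto_0[of p]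
    by (simp add: field_simps)
  moreover have "eventually (\<lambda>t. poly p (1 / t) * exp (- (1 / t)) = flat p t) (at_right 0)"
    by (auto simp: flat_def eventually_at_filter)
  ultimately have right: "(flat p \<longlongrightarrow> 0) (at_right 0)"
    by (rule Lim_transform_eventually)
  have "eventually (\<lambda>t. 0 = flat p t) (at_left 0)"
    by (auto simp: flat_def eventually_at_filter)
  with tendsto_const have "(flat p \<longlongrightarrow> 0) (at_left 0)"
    by (rule Lim_transform_eventually)
  with right show ?thesis
    by (simp add: filterlim_at_split)
qed

text \<open>With \<open>x = 1 / t\<close> the chain rule contributes the factor
  \<open>- x^2\<close>, and differentiating \<open>p(x) exp(-x)\<close> in \<open>x\<close> gives
  \<open>p' - p\<close>; the product is the new polynomial.\<close>

lemma flat_has_derivative: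
  "(flat p has_real_derivative flat ([:0, 0, 1:] * (p - pderiv p)) t) (at t)"
proof -
  consider "t > 0" | "t < 0" | "t = 0" by linarith
  then show ?thesis
  proof cases
    case 1
    have "((\<lambda>t. poly p (1 / t) * exp (- (1 / t))) has_real_derivative
        flat ([:0, 0, 1:] * (p - pderiv p)) t) (at t)"
      using 1 by (auto intro!: derivative_eq_intros poly_DERIV[THEN DERIV_chain2]
          simp: flat_def field_simps power2_eq_square)
    then show ?thesis
      by (rule has_field_derivative_transform_within_open[where S = "{0<..}"])
        (use 1 in \<open>auto simp: flat_def\<close>)
  next
    case 2
    have "((\<lambda>t. 0) has_real_derivative flat ([:0, 0, 1:] * (p - pderiv p)) t) (at t)"
      using 2 by (simp add: flat_def)
    then show ?thesis
      by (rule has_field_derivative_transform_within_open[where S = "{..<0}"])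
        (use 2 in \<open>auto simp: flat_def\<close>)
  next
    case 3
    have "flat q 0 = 0" for q
      by (simp add: flat_def)
    \<comment> \<open>Dividing by \<open>h\<close> multiplies the polynomial by its variable, so the
      difference quotient at 0 is again in the family and tends to 0.\<close>
    moreover have "flat p h / h = flat ([:0, 1:] * p) h" for h
      by (simp add: flat_def)
    ultimately show ?thesis
      using flat_tendsto_0[of "[:0, 1:] * p"] 3
      by (simp add: has_field_derivative_iff)
  qed
qed

lemma flat_1_bounds: "0 \<le> flat 1 t" "flat 1 t \<le> 1" "0 < flat 1 t \<longleftrightarrow> 0 < t"
  by (auto simp: flat_def)

text \<open>Since \<open>smooth\<close> speaks of all iterated partial derivatives, a class closed
  under \<open>partial\<close> reduces it to differentiability of the members. The sign of
  \<open>s\<close> decides on which side of a threshold a factor vanishes.\<close>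

inductive flat_algebra :: "(real ^ 'd \<Rightarrow> real) \<Rightarrow> bool" where
  const: "flat_algebra (\<lambda>x. c)"
| flat: "flat_algebra (\<lambda>x. flat p (c + s * x $ j))"
| add: "flat_algebra f \<Longrightarrow> flat_algebra g \<Longrightarrow> flat_algebra (\<lambda>x. f x + g x)"
| mult: "flat_algebra f \<Longrightarrow> flat_algebra g \<Longrightarrow> flat_algebra (\<lambda>x. f x * g x)"

text \<open>The sum and product rules express the derivative along a fixed direction
  \<open>v\<close> through functions already known to be in the class, which is what the induction
  needs.\<close>

lemma flat_algebra_has_derivative:
  fixes f :: "real ^ 'd \<Rightarrow> real"
  assumes "flat_algebra f"
  shows "\<exists>f'. (\<forall>x. (f has_derivative f' x) (at x)) \<and> (\<forall>v. flat_algebra (\<lambda>x. f' x v))"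
  using assms
proof induction
  case (const c)
  show ?case
    by (rule exI[of _ "\<lambda>x v. 0"]) (auto intro: flat_algebra.const)
next
  case (flat p c s j)
  let ?p' = "[:0, 0, 1:] * (p - pderiv p)"
  have "((\<lambda>x. flat p (c + s * x $ j)) has_derivative (\<lambda>v. flat ?p' (c + s * x $ j) * (s * v $ j))) (at x)"
    for x :: "real ^ 'd"
    by (rule has_derivative_compose[where g = "flat p" and f = "\<lambda>x. c + s * x $ j",
          OF _ flat_has_derivative[THEN has_field_derivative_imp_has_derivative]])
      (auto intro!: derivative_eq_intros bounded_linear.has_derivative[OF bounded_linear_vec_nth])
  then show ?case
    by (intro exI[of _ "\<lambda>x v. flat ?p' (c + s * x $ j) * (s * v $ j)"] conjI allI
        flat_algebra.mult flat_algebra.flat flat_algebra.const)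
next
  case (add f g)
  then obtain f' g' where "\<And>x. (f has_derivative f' x) (at x)" "\<And>v. flat_algebra (\<lambda>x. f' x v)"
    "\<And>x. (g has_derivative g' x) (at x)" "\<And>v. flat_algebra (\<lambda>x. g' x v)"
    by metis
  then show ?case
    by (intro exI[of _ "\<lambda>x v. f' x v + g' x v"] conjI allI flat_algebra.add has_derivative_add)
next
  case (mult f g)
  then obtain f' g' where "\<And>x. (f has_derivative f' x) (at x)" "\<And>v. flat_algebra (\<lambda>x. f' x v)"
    "\<And>x. (g has_derivative g' x) (at x)" "\<And>v. flat_algebra (\<lambda>x. g' x v)"
    by metis
  then show ?case
    using mult.hyps by (intro exI[of _ "\<lambda>x v. f x * g' x v + f' x v * g x"] conjI allI
        flat_algebra.add flat_algebra.mult has_derivative_mult)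
qed

lemma flat_algebra_partial:
  assumes "flat_algebra f"
  shows "f differentiable (at x)" "flat_algebra (partial j f)"
proof -
  obtain f' where f': "\<And>x. (f has_derivative f' x) (at x)" "\<And>v. flat_algebra (\<lambda>x. f' x v)"
    using flat_algebra_has_derivative[OF assms] by blast
  then show "f differentiable (at x)"
    unfolding differentiable_def by blast
  have "partial j f = (\<lambda>x. f' x (axis j 1))"
    by (simp add: partial_def fun_eq_iff frechet_derivative_at[OF f'(1), symmetric])
  with f'(2) show "flat_algebra (partial j f)"
    by simp
qed

lemma flat_algebra_smooth:
  assumes "flat_algebra f"
  shows "smooth f"
proof -
  have "flat_algebra (foldr partial js f)" for js
    by (induction js) (use assms flat_algebra_partial(2) in auto)
  then show ?thesis
    by (simp add: smooth_def flat_algebra_partial(1))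
qed

lemma flat_algebra_prod:
  assumes "\<And>i. i \<in> I \<Longrightarrow> flat_algebra (f i)"
  shows "flat_algebra (\<lambda>x. \<Prod>i\<in>I. f i x)"
  using assms by (induction I rule: infinite_finite_induct) (auto intro: flat_algebra.intros)

lemma flat_algebra_one_minus:
  assumes "flat_algebra f"
  shows "flat_algebra (\<lambda>x. 1 - f x)"
  using flat_algebra.add[OF flat_algebra.const[of 1]
      flat_algebra.mult[OF flat_algebra.const[of "-1"] assms]] by simp

lemma flat_algebra_power:
  assumes "flat_algebra f"
  shows "flat_algebra (\<lambda>x. f x ^ n)"
  using flat_algebra_prod[of "{..<n}" "\<lambda>_. f"] assms by simp

section \<open>Bumps on boxes and approximation of indicators of open sets\<close>

definition bump :: "real ^ 'd \<Rightarrow> real ^ 'd \<Rightarrow> real ^ 'd \<Rightarrow> real" where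
  "bump a b x = (\<Prod>j\<in>UNIV. flat 1 (x $ j - a $ j) * flat 1 (b $ j - x $ j))"

lemma flat_algebra_bump:
  fixes a b :: "real ^ 'd"
  shows "flat_algebra (bump a b)"
proof -
  have "flat_algebra (\<lambda>x::real^'d. flat 1 (x $ j - a $ j))" for j
    using flat_algebra.flat[of 1 "- a $ j" 1 j] by simp
  moreover have "flat_algebra (\<lambda>x::real^'d. flat 1 (b $ j - x $ j))" for j
    using flat_algebra.flat[of 1 "b $ j" "-1" j] by simp
  ultimately show ?thesis
    unfolding bump_def by (intro flat_algebra_prod flat_algebra.mult)
qed

lemma bump_bounds: "0 \<le> bump a b x" "bump a b x \<le> 1"
  unfolding bump_def
  by (auto intro!: prod_nonneg prod_le_1 mult_le_one mult_nonneg_nonneg flat_1_bounds)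

lemma bump_eq_0_iff: "bump a b x = 0 \<longleftrightarrow> x \<notin> box a b"
proof -
  have "flat 1 t = 0 \<longleftrightarrow> \<not> 0 < t" for t
    using flat_1_bounds[of t] by linarith
  then show ?thesis
    by (auto simp: bump_def mem_box_cart)
qed

text \<open>Lindelof's theorem extracts a countable subfamily from all boxes whose closed version
  lies in \<open>U\<close>. The closed boxes will later contain the supports.\<close>

lemma open_eq_Union_boxes:
  fixes U :: "'a::euclidean_space set"
  assumes "open U"
  obtains a b :: "nat \<Rightarrow> 'a" where "U = (\<Union>i. box (a i) (b i))" "\<And>i. cbox (a i) (b i) \<subseteq> U"
proof -
  define F where "F = {(a, b). cbox a b \<subseteq> U}"
  obtain \<B> where \<B>: "\<B> \<subseteq> (\<lambda>(a, b). box a b) ` F" "countable \<B>"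
      "\<Union>\<B> = \<Union>((\<lambda>(a, b). box a b) ` F)"
    by (rule Lindelof[of "(\<lambda>(a, b). box a b) ` F"]) (auto simp: open_box)
  then obtain G where G: "G \<subseteq> F" "countable G" "\<B> = (\<lambda>(a, b). box a b) ` G"
    using countable_subset_image[of \<B> "\<lambda>(a, b). box a b" F] by blast
  \<comment> \<open>The pair \<open>(e, 0)\<close> describes an empty box. Inserting it makes the
    index set nonempty, so that \<open>from_nat_into\<close> enumerates it even if \<open>G\<close>
    is empty.\<close>
  obtain e :: 'a where "e \<in> Basis"
    using nonempty_Basis by blast
  then have "\<exists>i\<in>Basis. 0 \<bullet> i < e \<bullet> i"
    by (intro bexI[of _ e]) auto
  then have "(e, 0) \<in> F"
    by (simp add: F_def box_eq_empty(2)[THEN iffD2])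
  define c where "c = from_nat_into (insert (e, 0) G)"
  have c: "range c = insert (e, 0) G"
    unfolding c_def using G(2) by (intro range_from_nat_into) simp_all
  have cbox: "cbox (fst (c i)) (snd (c i)) \<subseteq> U" for i
  proof -
    have "c i \<in> insert (e, 0) G"
      unfolding c[symmetric] by (rule rangeI)
    then have "c i \<in> F"
      using G(1) \<open>(e, 0) \<in> F\<close> by auto
    then show ?thesis by (auto simp: F_def)
  qed
  have "x \<in> (\<Union>i. box (fst (c i)) (snd (c i)))" if "x \<in> U" for x
  proof -
    obtain a b where "cbox a b \<subseteq> U" "x \<in> box a b"
      using open_contains_cbox[OF assms \<open>x \<in> U\<close>] by metis
    then have "x \<in> \<Union>((\<lambda>(a, b). box a b) ` F)"
      by (auto simp: F_def)
    then obtain g where "g \<in> G" "x \<in> box (fst g) (snd g)"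
      unfolding \<B>(3)[symmetric] G(3) by auto
    moreover from \<open>g \<in> G\<close> have "g \<in> range c"
      by (simp add: c)
    then obtain i where "g = c i" by (rule rangeE)
    ultimately show ?thesis by auto
  qed
  moreover have "(\<Union>i. box (fst (c i)) (snd (c i))) \<subseteq> U"
    using cbox box_subset_cbox by blast
  ultimately have "U = (\<Union>i. box (fst (c i)) (snd (c i)))"
    by blast
  then show thesis
    using cbox by (rule that)
qed

text \<open>At a point of \<open>box (a k) (b k)\<close> the single factor of index
  \<open>k\<close>, raised to the power \<open>n\<close>, drives the product to 0, as the others are
  at most 1. Outside \<open>U\<close> all bumps vanish. Only finitely many boxes enter
  \<open>\<psi> n\<close>, so its support is compact; the uniform bound serves dominated
  convergence.\<close>

lemma indicator_open_limit_test_functions: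
  fixes U :: "(real ^ 'd) set"
  assumes "open U"
  obtains \<psi> where "\<And>n::nat. \<psi> n \<in> test_functions U" "\<And>n x. \<bar>\<psi> n x\<bar> \<le> 1"
    "\<And>x. (\<lambda>n. \<psi> n x) \<longlonglongrightarrow> indicator U x"
proof -
  obtain a b where U: "U = (\<Union>i::nat. box (a i) (b i))" and cbox: "\<And>i. cbox (a i) (b i) \<subseteq> U"
    using open_eq_Union_boxes[OF assms] by blast
  define \<psi> where "\<psi> n x = 1 - (\<Prod>i<n. (1 - bump (a i) (b i) x) ^ n)" for n :: nat and x
  have fac: "0 \<le> (1 - bump (a i) (b i) x) ^ n" "(1 - bump (a i) (b i) x) ^ n \<le> 1" for i x n
    using bump_bounds[of "a i" "b i" x] by (auto intro: power_le_one)
  have prod_le: "(\<Prod>i\<in>I. (1 - bump (a i) (b i) x) ^ n) \<le> 1"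
    and prod_ge: "0 \<le> (\<Prod>i\<in>I. (1 - bump (a i) (b i) x) ^ n)" for I x n
    using fac by (auto intro!: prod_le_1 prod_nonneg)
  show thesis
  proof
    fix n
    let ?K = "\<Union>i<n. cbox (a i) (b i)"
    have "compact ?K"
      by (intro compact_UN) auto
    have "{x. \<psi> n x \<noteq> 0} \<subseteq> ?K"
    proof
      fix x assume x: "x \<in> {x. \<psi> n x \<noteq> 0}"
      have "\<exists>i<n. bump (a i) (b i) x \<noteq> 0"
      proof (rule ccontr)
        assume "\<not> (\<exists>i<n. bump (a i) (b i) x \<noteq> 0)"
        then have "\<psi> n x = 0" by (simp add: \<psi>_def)
        with x show False by simp
      qed
      then show "x \<in> ?K"
        using box_subset_cbox by (auto simp: bump_eq_0_iff)
    qed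
    then have supp: "closure {x. \<psi> n x \<noteq> 0} \<subseteq> ?K"
      using \<open>compact ?K\<close> by (simp add: closure_minimal compact_imp_closed)
    moreover from this have "compact (closure {x. \<psi> n x \<noteq> 0})"
      using \<open>compact ?K\<close> by (meson bounded_subset closed_closure compact_eq_bounded_closed)
    moreover have "smooth (\<psi> n)"
      unfolding \<psi>_def by (intro flat_algebra_smooth flat_algebra_one_minus flat_algebra_prod
          flat_algebra_power flat_algebra_bump)
    ultimately show "\<psi> n \<in> test_functions U"
      using cbox by (fastforce simp: test_functions_def)
    show "\<bar>\<psi> n x\<bar> \<le> 1" for x
      using prod_le[of x n "{..<n}"] prod_ge[of x n "{..<n}"] by (simp add: \<psi>_def)
  next
    fix x
    show "(\<lambda>n. \<psi> n x) \<longlonglongrightarrow> indicator U x"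
    proof (cases "x \<in> U")
      case True
      then obtain k where k: "x \<in> box (a k) (b k)"
        using U by blast
      let ?t = "1 - bump (a k) (b k) x"
      have t: "0 \<le> ?t" "?t < 1"
        using bump_bounds[of "a k" "b k" x] bump_eq_0_iff[of "a k" "b k" x] k by linarith+
      have upper: "(\<Prod>i<n. (1 - bump (a i) (b i) x) ^ n) \<le> ?t ^ n" if "n > k" for n
      proof -
        have "(\<Prod>i<n. (1 - bump (a i) (b i) x) ^ n)
            = ?t ^ n * (\<Prod>i\<in>{..<n} - {k}. (1 - bump (a i) (b i) x) ^ n)"
          using that by (intro prod.remove) auto
        also have "\<dots> \<le> ?t ^ n"
          using fac(1)[where i = k] prod_le by (rule mult_right_le_one_le[OF _ prod_ge])
        finally show ?thesis .
      qed
      have "(\<lambda>n. \<Prod>i<n. (1 - bump (a i) (b i) x) ^ n) \<longlonglongrightarrow> 0"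
      proof (rule tendsto_sandwich)
        show "\<forall>\<^sub>F n in sequentially. 0 \<le> (\<Prod>i<n. (1 - bump (a i) (b i) x) ^ n)"
          by (simp add: prod_ge)
        show "\<forall>\<^sub>F n in sequentially. (\<Prod>i<n. (1 - bump (a i) (b i) x) ^ n) \<le> ?t ^ n"
          using eventually_gt_at_top[of k] by eventually_elim (rule upper)
        show "(\<lambda>n. ?t ^ n) \<longlonglongrightarrow> 0"
          using t by (intro LIMSEQ_power_zero) auto
      qed (rule tendsto_const)
      from tendsto_diff[OF tendsto_const this] show ?thesis
        using True by (simp add: \<psi>_def)
    next
      case False
      then have "bump (a i) (b i) x = 0" for i
        using U by (auto simp: bump_eq_0_iff)
      with False show ?thesis
        by (simp add: \<psi>_def)
    qed
  qed
qed

section \<open>Elementary properties of test functions\<close>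

lemma test_functions_mono:
  assumes "U \<subseteq> V"
  shows "test_functions U \<subseteq> test_functions V"
  using assms by (auto simp: test_functions_def)

lemma test_functions_continuous:
  assumes "\<phi> \<in> test_functions \<Omega>"
  shows "continuous_on UNIV \<phi>"
proof -
  \<comment> \<open>The empty list in the definition of \<open>smooth\<close> yields
    differentiability of the function itself.\<close>
  have "foldr partial [] \<phi> differentiable (at x)" for x
    using assms unfolding test_functions_def smooth_def by blast
  then show ?thesis
    by (simp add: continuous_at_imp_continuous_on differentiable_imp_continuous_within)
qed

lemma test_functions_measurable:
  assumes "\<phi> \<in> test_functions \<Omega>"
  shows "\<phi> \<in> borel_measurable (lebesgue_on S)"
  using test_functions_continuous[OF assms]
  by (metis borel_measurable_continuous_onI measurable_completion measurable_lborel2 measurable_restrict_space1)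

subsection \<open>The fundamental lemma of the calculus of variations\<close>

text \<open>The integral of \<open>g\<close> is shown to vanish over open subsets, then over
  countable intersections of them, then over all measurable subsets. Both limits are dominated by
  \<open>\<bar>g\<bar>\<close>.\<close>

lemma AE_zero_if_orthogonal_to_test_functions:
  fixes \<Omega> :: "(real ^ 'd) set"
  assumes "open \<Omega>" and g: "integrable (lebesgue_on \<Omega>) g"
    and orth: "\<And>\<phi>. \<phi> \<in> test_functions \<Omega> \<Longrightarrow> (LINT x|lebesgue_on \<Omega>. g x * \<phi> x) = 0"
  shows "AE x in lebesgue_on \<Omega>. g x = 0"
proof -
  note [measurable] = borel_measurable_integrable[OF g]
  have \<Omega>: "\<Omega> \<in> sets lebesgue"
    using \<open>open \<Omega>\<close> by auto
  have open_zero: "(LINT x|lebesgue_on \<Omega>. g x * indicator U x) = 0" if "open U" "U \<subseteq> \<Omega>" for U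
  proof -
    obtain \<psi> where \<psi>: "\<And>n::nat. \<psi> n \<in> test_functions U" "\<And>n x. \<bar>\<psi> n x\<bar> \<le> 1"
        "\<And>x. (\<lambda>n. \<psi> n x) \<longlonglongrightarrow> indicator U x"
      using indicator_open_limit_test_functions[OF \<open>open U\<close>] by metis
    have [measurable]: "\<psi> n \<in> borel_measurable (lebesgue_on \<Omega>)" for n
      using test_functions_measurable \<psi>(1) by blast
    have "(\<lambda>n. LINT x|lebesgue_on \<Omega>. g x * \<psi> n x) \<longlonglongrightarrow> (LINT x|lebesgue_on \<Omega>. g x * indicator U x)"
    proof (rule integral_dominated_convergence[where w = "\<lambda>x. \<bar>g x\<bar>"])
      show "(\<lambda>x. g x * indicator U x) \<in> borel_measurable (lebesgue_on \<Omega>)"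
        by (rule borel_measurable_LIMSEQ_real[where u = "\<lambda>n x. g x * \<psi> n x"])
          (auto intro: tendsto_mult \<psi>(3))
      show "AE x in lebesgue_on \<Omega>. norm (g x * \<psi> n x) \<le> \<bar>g x\<bar>" for n
        using \<psi>(2) by (auto simp: abs_mult intro!: AE_I2 mult_right_le_one_le)
    qed (use g in \<open>auto intro!: tendsto_mult \<psi>(3) AE_I2\<close>)
    moreover have "(LINT x|lebesgue_on \<Omega>. g x * \<psi> n x) = 0" for n
      using \<psi>(1) test_functions_mono[OF that(2)] by (auto intro: orth)
    ultimately show ?thesis
      by (simp add: LIMSEQ_const_iff)
  qed
  have set_zero: "(LINT x|lebesgue_on \<Omega>. g x * indicator A x) = 0"
    if A: "A \<in> sets (lebesgue_on \<Omega>)" for A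
  proof -
    have [measurable]: "A \<in> sets (lebesgue_on \<Omega>)" by fact
    have "A \<in> sets lebesgue" "A \<subseteq> \<Omega>"
      using A \<Omega> by (auto simp: sets_restrict_space_iff sets_restrict_space)
    then obtain C T where C: "gdelta C" "T \<in> null_sets lebesgue" "A \<union> T = C" "disjnt A T"
      using lebesgue_set_almost_gdelta by metis
    then obtain F :: "nat \<Rightarrow> (real ^ 'd) set" where F: "\<And>n. open (F n)" "C = \<Inter>(range F)"
      by (auto elim!: gdelta.cases)
    \<comment> \<open>Finite intersections make the open sets decreasing, and cutting with
      \<open>\<Omega>\<close> makes \<open>open_zero\<close> applicable.\<close>
    define U where "U n = \<Omega> \<inter> (\<Inter>i\<le>n. F i)" for n
    have U: "open (U n)" "U n \<subseteq> \<Omega>" for n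
      using F \<open>open \<Omega>\<close> by (auto simp: U_def intro!: open_INT)
    have meas[measurable]: "U n \<in> sets (lebesgue_on \<Omega>)" for n
      using U[of n] \<Omega> by (auto simp: sets_restrict_space_iff)
    have [measurable]: "C \<inter> \<Omega> \<in> sets (lebesgue_on \<Omega>)"
      using \<open>A \<in> sets lebesgue\<close> C(2,3) \<Omega> by (auto simp: sets_restrict_space_iff)
    have lim: "(\<lambda>n. indicator (U n) x) \<longlonglongrightarrow> (indicator (C \<inter> \<Omega>) x :: real)" for x
    proof -
      have "decseq U"
        by (auto simp: decseq_def U_def)
      moreover have "(\<Inter>n. U n) = C \<inter> \<Omega>"
        unfolding U_def F(2) by auto
      ultimately show ?thesis
        using LIMSEQ_indicator_decseq[of U x] by simp
    qed
    have "(\<lambda>n. LINT x|lebesgue_on \<Omega>. g x * indicator (U n) x)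
        \<longlonglongrightarrow> (LINT x|lebesgue_on \<Omega>. g x * indicator (C \<inter> \<Omega>) x)"
      by (rule integral_dominated_convergence[where w = "\<lambda>x. \<bar>g x\<bar>"])
        (use g in \<open>auto intro!: tendsto_mult lim AE_I2 simp: abs_mult mult_right_le_one_le\<close>)
    then have "(LINT x|lebesgue_on \<Omega>. g x * indicator (C \<inter> \<Omega>) x) = 0"
      using open_zero[OF U] by (simp add: LIMSEQ_const_iff)
    \<comment> \<open>Inside \<open>\<Omega>\<close> the sets \<open>C\<close> and \<open>A\<close>
      differ only on the null set \<open>T\<close>.\<close>
    moreover have "(LINT x|lebesgue_on \<Omega>. g x * indicator (C \<inter> \<Omega>) x)
        = (LINT x|lebesgue_on \<Omega>. g x * indicator A x)"
    proof (rule integral_cong_AE)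
      have "AE x in lebesgue. x \<notin> T"
        using C(2) by (rule AE_not_in)
      then have "AE x in lebesgue_on \<Omega>. x \<notin> T"
        using \<Omega> by (simp add: AE_restrict_space_iff) (auto elim: eventually_mono)
      then show "AE x in lebesgue_on \<Omega>. g x * indicator (C \<inter> \<Omega>) x = g x * indicator A x"
        using C(3) \<open>A \<subseteq> \<Omega>\<close> by (auto simp: indicator_def elim!: eventually_mono)
    qed (use A in measurable)
    ultimately show ?thesis by simp
  qed
  show ?thesis
    by (rule density_unique_real[OF g])
      (use set_zero in \<open>auto simp: set_lebesgue_integral_def mult.commute\<close>)
qed

subsection \<open>The geometry of \<open>L\<^sup>2\<close>\<close>

lemma L2_mult_integrable:
  assumes "f \<in> L2 \<Omega>" "g \<in> L2 \<Omega>"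
  shows "integrable (lebesgue_on \<Omega>) (\<lambda>x. f x * g x)"
proof (rule Bochner_Integration.integrable_bound)
  show "integrable (lebesgue_on \<Omega>) (\<lambda>x. (f x)\<^sup>2 + (g x)\<^sup>2)"
    using assms by (auto simp: L2_def)
  show "(\<lambda>x. f x * g x) \<in> borel_measurable (lebesgue_on \<Omega>)"
    using assms by (auto simp: L2_def)
  have "\<bar>a * b\<bar> \<le> a\<^sup>2 + b\<^sup>2" for a b :: real
    using sum_squares_bound[of "\<bar>a\<bar>" "\<bar>b\<bar>"] mult_nonneg_nonneg[of "\<bar>a\<bar>" "\<bar>b\<bar>"]
    unfolding abs_mult power2_abs by linarith
  then show "AE x in lebesgue_on \<Omega>. norm (f x * g x) \<le> norm ((f x)\<^sup>2 + (g x)\<^sup>2)"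
    by simp
qed

lemma L2_uminus: "f \<in> L2 \<Omega> \<Longrightarrow> (\<lambda>x. - f x) \<in> L2 \<Omega>"
  by (auto simp: L2_def)

lemma L2_add:
  assumes "f \<in> L2 \<Omega>" "g \<in> L2 \<Omega>"
  shows "(\<lambda>x. f x + g x) \<in> L2 \<Omega>"
proof -
  have "integrable (lebesgue_on \<Omega>) (\<lambda>x. (f x)\<^sup>2 + (g x)\<^sup>2 + 2 * (f x * g x))"
    using assms L2_mult_integrable[OF assms] by (auto simp: L2_def)
  with assms show ?thesis
    by (auto simp: L2_def power2_sum mult.assoc)
qed

lemma L2_diff:
  assumes "f \<in> L2 \<Omega>" "g \<in> L2 \<Omega>"
  shows "(\<lambda>x. f x - g x) \<in> L2 \<Omega>"
  using L2_add[OF assms(1) L2_uminus[OF assms(2)]] by simp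

lemma L2_inner_commute: "L2_inner \<Omega> f g = L2_inner \<Omega> g f"
  by (simp add: L2_inner_def mult.commute)

lemma L2_inner_add_right:
  assumes "f \<in> L2 \<Omega>" "g \<in> L2 \<Omega>" "h \<in> L2 \<Omega>"
  shows "L2_inner \<Omega> f (\<lambda>x. g x + h x) = L2_inner \<Omega> f g + L2_inner \<Omega> f h"
  using assms by (simp add: L2_inner_def distrib_left L2_mult_integrable)

lemma L2_inner_uminus_left: "L2_inner \<Omega> (\<lambda>x. - f x) g = - L2_inner \<Omega> f g"
  by (simp add: L2_inner_def)

lemma L2_norm_nonneg: "0 \<le> L2_norm \<Omega> f"
  by (simp add: L2_norm_def L2_inner_def)

lemma L2_norm_power2: "(L2_norm \<Omega> f)\<^sup>2 = L2_inner \<Omega> f f"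
  by (simp add: L2_norm_def L2_inner_def)

lemma L2_norm_eq_0_iff:
  assumes "f \<in> L2 \<Omega>"
  shows "L2_norm \<Omega> f = 0 \<longleftrightarrow> \<not> nonzero_on \<Omega> f"
proof -
  have "L2_inner \<Omega> f f = 0 \<longleftrightarrow> (AE x in lebesgue_on \<Omega>. f x * f x = 0)"
    unfolding L2_inner_def using L2_mult_integrable[OF assms assms]
    by (intro integral_nonneg_eq_0_iff_AE) auto
  then show ?thesis
    by (simp add: L2_norm_def nonzero_on_def)
qed

lemma L2_Cauchy_Schwarz:
  assumes "f \<in> L2 \<Omega>" "g \<in> L2 \<Omega>"
  shows "L2_inner \<Omega> f g \<le> L2_norm \<Omega> f * L2_norm \<Omega> g"
proof -
  let ?a = "L2_norm \<Omega> f" and ?b = "L2_norm \<Omega> g"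
  \<comment> \<open>The degenerate case: a function of norm 0 vanishes almost everywhere and is
    orthogonal to everything.\<close>
  have zero: "L2_inner \<Omega> h k = 0" if "h \<in> L2 \<Omega>" "L2_norm \<Omega> h = 0" for h k
  proof -
    have "AE x in lebesgue_on \<Omega>. h x * k x = 0"
      using that L2_norm_eq_0_iff[of h \<Omega>] by (auto simp: nonzero_on_def elim: eventually_mono)
    then show ?thesis
      by (simp add: L2_inner_def integral_eq_zero_AE)
  qed
  show ?thesis
  proof (cases "?a = 0 \<or> ?b = 0")
    case True
    then show ?thesis
      using zero[OF assms(1)] zero[OF assms(2), of f] L2_inner_commute[of \<Omega> f g] by auto
  next
    case False
    then have pos: "0 < ?a * ?b"
      using L2_norm_nonneg[of \<Omega> f] L2_norm_nonneg[of \<Omega> g] by (simp add: less_le)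
    \<comment> \<open>The weights make both square terms equal to
      \<open>?a\<^sup>2 * ?b\<^sup>2\<close>, so that \<open>2 * (?a * ?b)\<close> factors out of
      the expansion.\<close>
    have "0 \<le> (LINT x|lebesgue_on \<Omega>. (?b * f x - ?a * g x)\<^sup>2)"
      by simp
    also have "\<dots> = (LINT x|lebesgue_on \<Omega>.
        ?b\<^sup>2 * (f x * f x) + ?a\<^sup>2 * (g x * g x) - 2 * (?a * ?b) * (f x * g x))"
      by (simp add: power2_eq_square algebra_simps)
    also have "\<dots> = ?b\<^sup>2 * L2_inner \<Omega> f f + ?a\<^sup>2 * L2_inner \<Omega> g g - 2 * (?a * ?b) * L2_inner \<Omega> f g"
      using assms by (simp add: L2_inner_def L2_mult_integrable)
    also have "\<dots> = 2 * (?a * ?b) * (?a * ?b - L2_inner \<Omega> f g)"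
      by (simp only: L2_norm_power2[symmetric]) (simp add: power2_eq_square algebra_simps)
    finally show ?thesis
      using pos by (simp add: zero_le_mult_iff)
  qed
qed

lemma L2_Cauchy_Schwarz_abs:
  assumes "f \<in> L2 \<Omega>" "g \<in> L2 \<Omega>"
  shows "\<bar>L2_inner \<Omega> f g\<bar> \<le> L2_norm \<Omega> f * L2_norm \<Omega> g"
  using L2_Cauchy_Schwarz[OF assms] L2_Cauchy_Schwarz[OF L2_uminus[OF assms(1)] assms(2)]
  by (simp add: L2_inner_uminus_left L2_norm_def L2_inner_def)

lemma L2_norm_triangle:
  assumes "f \<in> L2 \<Omega>" "g \<in> L2 \<Omega>"
  shows "L2_norm \<Omega> (\<lambda>x. f x + g x) \<le> L2_norm \<Omega> f + L2_norm \<Omega> g"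
proof -
  have sum: "(\<lambda>x. f x + g x) \<in> L2 \<Omega>"
    using assms by (rule L2_add)
  have "(L2_norm \<Omega> (\<lambda>x. f x + g x))\<^sup>2 = (L2_norm \<Omega> f)\<^sup>2 + 2 * L2_inner \<Omega> f g + (L2_norm \<Omega> g)\<^sup>2"
    using assms by (simp add: L2_norm_power2 L2_inner_def L2_mult_integrable distrib_left distrib_right
        mult.commute[of "g _" "f _"])
  also have "\<dots> \<le> (L2_norm \<Omega> f + L2_norm \<Omega> g)\<^sup>2"
    using L2_Cauchy_Schwarz[OF assms] by (simp add: power2_sum)
  finally show ?thesis
    by (rule power2_le_imp_le) (intro add_nonneg_nonneg L2_norm_nonneg)
qed

text \<open>This is the reverse triangle inequality, obtained from the triangle inequality for
  \<open>p n = (p n - q) + q\<close> and for \<open>q = (q - p n) + p n\<close>.\<close>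

lemma L2_norm_tendsto:
  assumes "\<And>n. p n \<in> L2 \<Omega>" "q \<in> L2 \<Omega>" "(\<lambda>n. L2_norm \<Omega> (\<lambda>x. p n x - q x)) \<longlonglongrightarrow> 0"
  shows "(\<lambda>n. L2_norm \<Omega> (p n)) \<longlonglongrightarrow> L2_norm \<Omega> q"
proof (rule LIM_zero_cancel, rule Lim_null_comparison[OF _ assms(3)], rule always_eventually, rule allI)
  fix n
  let ?d = "\<lambda>x. p n x - q x"
  have d: "?d \<in> L2 \<Omega>"
    using assms(1,2) by (rule L2_diff)
  have "L2_norm \<Omega> (p n) \<le> L2_norm \<Omega> ?d + L2_norm \<Omega> q"
    using L2_norm_triangle[OF d assms(2)] by simp
  moreover have "L2_norm \<Omega> q \<le> L2_norm \<Omega> (\<lambda>x. - ?d x) + L2_norm \<Omega> (p n)"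
    using L2_norm_triangle[OF L2_uminus[OF d] assms(1)[of n]] by simp
  moreover have "L2_norm \<Omega> (\<lambda>x. - ?d x) = L2_norm \<Omega> ?d"
    unfolding L2_norm_def L2_inner_def by (simp only: minus_mult_minus)
  ultimately show "norm (L2_norm \<Omega> (p n) - L2_norm \<Omega> q) \<le> L2_norm \<Omega> ?d"
    by simp
qed

subsection \<open>Uniqueness and oddness of weak derivatives\<close>

lemma finite_measure_lebesgue_on_bounded:
  assumes "open \<Omega>" "bounded \<Omega>"
  shows "finite_measure (lebesgue_on \<Omega>)"
  using assms by (intro finite_measure_lebesgue_on bounded_set_imp_lmeasurable) auto

lemma L2_if_bounded:
  assumes "open \<Omega>" "bounded \<Omega>" "f \<in> borel_measurable (lebesgue_on \<Omega>)" "\<And>x. \<bar>f x\<bar> \<le> B"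
  shows "f \<in> L2 \<Omega>"
proof -
  interpret finite_measure "lebesgue_on \<Omega>"
    using assms by (intro finite_measure_lebesgue_on_bounded)
  have "(f x)\<^sup>2 \<le> B\<^sup>2" for x
    using assms(4)[of x] by (simp add: abs_le_square_iff[symmetric])
  then have "integrable (lebesgue_on \<Omega>) (\<lambda>x. (f x)\<^sup>2)"
    using assms(3) by (intro integrable_const_bound[where B = "B\<^sup>2"]) auto
  with assms(3) show ?thesis
    by (simp add: L2_def)
qed

lemma test_functions_bounded:
  assumes "\<phi> \<in> test_functions \<Omega>"
  obtains B where "\<And>x. \<bar>\<phi> x\<bar> \<le> B"
proof -
  let ?K = "closure {x. \<phi> x \<noteq> 0}"
  have "compact ?K"
    using assms by (simp add: test_functions_def)
  then have "bounded (\<phi> ` ?K)"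
    using test_functions_continuous[OF assms]
    by (intro compact_imp_bounded compact_continuous_image) (auto intro: continuous_on_subset)
  then obtain B where B: "B > 0" "\<And>x. x \<in> ?K \<Longrightarrow> \<bar>\<phi> x\<bar> \<le> B"
    by (auto simp: bounded_pos)
  have "\<bar>\<phi> x\<bar> \<le> B" for x
    using B closure_subset[of "{x. \<phi> x \<noteq> 0}"] by (cases "\<phi> x = 0") auto
  then show thesis by (rule that)
qed

lemma test_functions_L2:
  assumes "open \<Omega>" "bounded \<Omega>" "\<phi> \<in> test_functions \<Omega>"
  shows "\<phi> \<in> L2 \<Omega>"
  using test_functions_bounded[OF assms(3)] L2_if_bounded[OF assms(1,2)]
    test_functions_measurable[OF assms(3)] by metis

text \<open>The difference of two weak derivatives is orthogonal to every test function, so the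
  fundamental lemma applies.\<close>

lemma weak_partial_unique:
  assumes "open \<Omega>" "bounded \<Omega>" "g \<in> L2 \<Omega>" "h \<in> L2 \<Omega>"
    and "is_weak_partial \<Omega> j u g" "is_weak_partial \<Omega> j u h"
  shows "AE x in lebesgue_on \<Omega>. g x = h x"
proof -
  let ?d = "\<lambda>x. g x - h x"
  have d: "?d \<in> L2 \<Omega>"
    using assms(3,4) by (rule L2_diff)
  \<comment> \<open>Pairing with the constant 1, square integrable as \<open>\<Omega>\<close> is
    bounded, turns the \<open>L2\<close> difference into an integrable function.\<close>
  have "(\<lambda>x. 1) \<in> L2 \<Omega>"
    using assms(1,2) by (rule L2_if_bounded[where B = 1]) auto
  from L2_mult_integrable[OF d this] have "integrable (lebesgue_on \<Omega>) ?d"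
    by simp
  moreover have "(LINT x|lebesgue_on \<Omega>. ?d x * \<phi> x) = 0" if "\<phi> \<in> test_functions \<Omega>" for \<phi>
  proof -
    have "\<phi> \<in> L2 \<Omega>"
      using assms(1,2) that by (rule test_functions_L2)
    then have "(LINT x|lebesgue_on \<Omega>. ?d x * \<phi> x) = L2_inner \<Omega> g \<phi> - L2_inner \<Omega> h \<phi>"
      using assms(3,4) by (simp add: L2_inner_def left_diff_distrib L2_mult_integrable)
    also have "\<dots> = 0"
      using assms(5,6) that by (simp add: is_weak_partial_def)
    finally show ?thesis .
  qed
  ultimately have "AE x in lebesgue_on \<Omega>. ?d x = 0"
    using \<open>open \<Omega>\<close> by (intro AE_zero_if_orthogonal_to_test_functions)
  then show ?thesis by simp
qed

lemma weak_partial_H1: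
  assumes "u \<in> H1 \<Omega>"
  shows "weak_partial \<Omega> j u \<in> L2 \<Omega>" "is_weak_partial \<Omega> j u (weak_partial \<Omega> j u)"
proof -
  have "\<exists>g. g \<in> L2 \<Omega> \<and> is_weak_partial \<Omega> j u g"
    using assms by (auto simp: H1_def)
  from someI_ex[OF this] show "weak_partial \<Omega> j u \<in> L2 \<Omega>"
    "is_weak_partial \<Omega> j u (weak_partial \<Omega> j u)"
    by (simp_all add: weak_partial_def)
qed

lemma is_weak_partial_uminus:
  "is_weak_partial \<Omega> j (\<lambda>x. - u x) (\<lambda>x. - g x) \<longleftrightarrow> is_weak_partial \<Omega> j u g"
  by (auto simp: is_weak_partial_def L2_inner_uminus_left minus_equation_iff[of "L2_inner _ u _"])

text \<open>The choices for \<open>u\<close> and for \<open>- u\<close> are made independently, so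
  only equality almost everywhere can hold; it comes from uniqueness, as both sides are weak
  derivatives of \<open>- u\<close>.\<close>

lemma weak_partial_uminus:
  assumes "open \<Omega>" "bounded \<Omega>"
    and "g \<in> L2 \<Omega>" "is_weak_partial \<Omega> j u g"
  shows "AE x in lebesgue_on \<Omega>. weak_partial \<Omega> j (\<lambda>x. - u x) x = - weak_partial \<Omega> j u x"
proof -
  let ?P = "\<lambda>w h. h \<in> L2 \<Omega> \<and> is_weak_partial \<Omega> j w h"
  have "?P u (weak_partial \<Omega> j u)"
    unfolding weak_partial_def using assms(3,4) by (intro someI[where P = "?P u"]) simp
  then have neg: "?P (\<lambda>x. - u x) (\<lambda>x. - weak_partial \<Omega> j u x)"
    by (simp add: L2_uminus is_weak_partial_uminus)
  then have "?P (\<lambda>x. - u x) (weak_partial \<Omega> j (\<lambda>x. - u x))"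
    unfolding weak_partial_def[of \<Omega> j "\<lambda>x. - u x"] by (rule someI[where P = "?P (\<lambda>x. - u x)"])
  with neg show ?thesis
    using weak_partial_unique[OF assms(1,2)] by blast
qed

text \<open>No regularity of \<open>u\<close> is assumed: without a weak derivative in \<open>L\<^sup>2\<close> both sides are the
  norm of the same arbitrary choice from an empty predicate.\<close>

lemma L2_norm_weak_partial_uminus:
  assumes "open \<Omega>" "bounded \<Omega>"
  shows "L2_norm \<Omega> (weak_partial \<Omega> j (\<lambda>x. - u x)) = L2_norm \<Omega> (weak_partial \<Omega> j u)"
proof (cases "\<exists>g. g \<in> L2 \<Omega> \<and> is_weak_partial \<Omega> j u g")
  case True
  then obtain g where g: "g \<in> L2 \<Omega>" "is_weak_partial \<Omega> j u g" by blast
  have "weak_partial \<Omega> j u \<in> L2 \<Omega>"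
    unfolding weak_partial_def using someI_ex[OF True] by simp
  moreover have "\<exists>g. g \<in> L2 \<Omega> \<and> is_weak_partial \<Omega> j (\<lambda>x. - u x) g"
    using g by (intro exI[of _ "\<lambda>x. - g x"]) (simp add: L2_uminus is_weak_partial_uminus)
  from someI_ex[OF this] have "weak_partial \<Omega> j (\<lambda>x. - u x) \<in> L2 \<Omega>"
    unfolding weak_partial_def by simp
  ultimately have "L2_inner \<Omega> (weak_partial \<Omega> j (\<lambda>x. - u x)) (weak_partial \<Omega> j (\<lambda>x. - u x))
      = L2_inner \<Omega> (weak_partial \<Omega> j u) (weak_partial \<Omega> j u)"
    unfolding L2_inner_def using weak_partial_uminus[OF assms g]
    by (intro integral_cong_AE) (auto simp: L2_def elim: eventually_mono)
  then show ?thesis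
    by (simp add: L2_norm_def)
next
  case False
  have "\<not> (g \<in> L2 \<Omega> \<and> is_weak_partial \<Omega> j (\<lambda>x. - u x) g)" for g
    using False L2_uminus[of g \<Omega>] is_weak_partial_uminus[of \<Omega> j "\<lambda>x. - u x" g] by auto
  with False have "(\<lambda>g. g \<in> L2 \<Omega> \<and> is_weak_partial \<Omega> j (\<lambda>x. - u x) g)
      = (\<lambda>g. g \<in> L2 \<Omega> \<and> is_weak_partial \<Omega> j u g)"
    by blast
  then show ?thesis
    by (simp only: weak_partial_def)
qed

text \<open>Holding for arbitrary \<open>u\<close>, this applies in \<open>H10_uminus\<close> to
  \<open>\<phi> n - u\<close> without a proof that the difference lies in
  \<open>H1 \<Omega>\<close>.\<close>

lemma H1_seminorm_uminus:
  assumes "open \<Omega>" "bounded \<Omega>"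
  shows "H1_seminorm \<Omega> (\<lambda>x. - u x) = H1_seminorm \<Omega> u"
  by (simp add: H1_seminorm_def L2_norm_weak_partial_uminus[OF assms])

section \<open>Invariance of the function spaces under negation\<close>

lemma partial_uminus:
  assumes "\<And>x. f differentiable (at x)"
  shows "partial j (\<lambda>x. - f x) = (\<lambda>x. - partial j f x)"
proof
  fix x
  have "((\<lambda>x. - f x) has_derivative (\<lambda>v. - frechet_derivative f (at x) v)) (at x)"
    using assms[of x] by (intro has_derivative_minus) (simp add: frechet_derivative_works)
  from frechet_derivative_at[OF this] show "partial j (\<lambda>x. - f x) x = - partial j f x"
    unfolding partial_def by (simp add: fun_eq_iff)
qed

lemma smooth_uminus:
  assumes "smooth f"
  shows "smooth (\<lambda>x. - f x)"
proof -
  have diff: "foldr partial js f differentiable (at x)" for js x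
    using assms by (simp add: smooth_def)
  have "foldr partial js (\<lambda>x. - f x) = (\<lambda>x. - foldr partial js f x)" for js
    by (induction js) (simp_all add: partial_uminus diff)
  then show ?thesis
    by (simp add: smooth_def diff)
qed

lemma test_functions_uminus: "\<phi> \<in> test_functions \<Omega> \<Longrightarrow> (\<lambda>x. - \<phi> x) \<in> test_functions \<Omega>"
  by (simp add: test_functions_def smooth_uminus)

lemma H1_uminus:
  assumes "u \<in> H1 \<Omega>"
  shows "(\<lambda>x. - u x) \<in> H1 \<Omega>"
proof -
  have "\<exists>g\<in>L2 \<Omega>. is_weak_partial \<Omega> j (\<lambda>x. - u x) g" for j
    using weak_partial_H1[OF assms, of j]
    by (intro bexI[of _ "\<lambda>x. - weak_partial \<Omega> j u x"]) (simp_all add: is_weak_partial_uminus L2_uminus)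
  with assms show ?thesis
    by (simp add: H1_def L2_uminus)
qed

text \<open>The negated test functions approximate \<open>- u\<close> with the same errors.\<close>

lemma H10_uminus:
  assumes "open \<Omega>" "bounded \<Omega>" "u \<in> H10 \<Omega>"
  shows "(\<lambda>x. - u x) \<in> H10 \<Omega>"
proof -
  obtain \<phi> where \<phi>: "\<And>n. \<phi> n \<in> test_functions \<Omega>"
    "(\<lambda>n. H1_seminorm \<Omega> (\<lambda>x. \<phi> n x - u x)) \<longlonglongrightarrow> 0" "(\<lambda>n. L2_norm \<Omega> (\<lambda>x. \<phi> n x - u x)) \<longlonglongrightarrow> 0"
    using assms(3) by (auto simp: H10_def)
  have neg: "(\<lambda>x. - \<phi> n x - - u x) = (\<lambda>x. - (\<phi> n x - u x))" for n
    by auto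
  have "H1_seminorm \<Omega> (\<lambda>x. - \<phi> n x - - u x) = H1_seminorm \<Omega> (\<lambda>x. \<phi> n x - u x)" for n
    unfolding neg by (rule H1_seminorm_uminus[OF assms(1,2)])
  moreover have "L2_norm \<Omega> (\<lambda>x. - \<phi> n x - - u x) = L2_norm \<Omega> (\<lambda>x. \<phi> n x - u x)" for n
    unfolding neg L2_norm_def L2_inner_def by (simp only: minus_mult_minus)
  ultimately have "\<exists>\<psi>. (\<forall>n. \<psi> n \<in> test_functions \<Omega>) \<and>
      (\<lambda>n. H1_seminorm \<Omega> (\<lambda>x. \<psi> n x - - u x)) \<longlonglongrightarrow> 0 \<and>
      (\<lambda>n. L2_norm \<Omega> (\<lambda>x. \<psi> n x - - u x)) \<longlonglongrightarrow> 0"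
    using \<phi> by (intro exI[of _ "\<lambda>n x. - \<phi> n x"]) (simp only: test_functions_uminus simp_thms)
  with assms(3) show ?thesis
    unfolding H10_def mem_Collect_eq by (blast intro: H1_uminus)
qed

lemma H10_vec_uminus:
  assumes "open \<Omega>" "bounded \<Omega>" "v \<in> H10_vec \<Omega>"
  shows "(\<lambda>x. - v x) \<in> H10_vec \<Omega>"
  using assms by (simp add: H10_vec_def H10_uminus)

lemma H10_vec_component_H1: "v \<in> H10_vec \<Omega> \<Longrightarrow> (\<lambda>x. v x $ k) \<in> H1 \<Omega>"
  by (simp add: H10_vec_def H10_def)

lemma H1_seminorm_vec_uminus:
  assumes "open \<Omega>" "bounded \<Omega>"
  shows "H1_seminorm_vec \<Omega> (\<lambda>x. - v x) = H1_seminorm_vec \<Omega> v"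
  by (simp add: H1_seminorm_vec_def L2_norm_weak_partial_uminus[OF assms])

lemma H1_seminorm_vec_nonneg: "0 \<le> H1_seminorm_vec \<Omega> v"
  by (simp add: H1_seminorm_vec_def sum_nonneg)

section \<open>The divergence: oddness and boundedness\<close>

lemma divergence_L2:
  assumes "v \<in> H10_vec \<Omega>"
  shows "divergence \<Omega> v \<in> L2 \<Omega>"
proof -
  have "(\<lambda>x. \<Sum>j\<in>J. weak_partial \<Omega> j (\<lambda>y. v y $ j) x) \<in> L2 \<Omega>" if "finite J" for J
    using that
  proof induction
    case empty
    show ?case by (simp add: L2_def)
  next
    case (insert j J)
    then show ?case
      by (simp add: L2_add weak_partial_H1(1) H10_vec_component_H1[OF assms])
  qed
  then show ?thesis
    unfolding divergence_def by simp
qed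

text \<open>There are finitely many components, so their exceptional null sets combine into
  one.\<close>

lemma divergence_uminus:
  assumes "open \<Omega>" "bounded \<Omega>" "v \<in> H10_vec \<Omega>"
  shows "AE x in lebesgue_on \<Omega>. divergence \<Omega> (\<lambda>x. - v x) x = - divergence \<Omega> v x"
proof -
  have "AE x in lebesgue_on \<Omega>. \<forall>j\<in>UNIV. weak_partial \<Omega> j (\<lambda>x. - (v x $ j)) x = - weak_partial \<Omega> j (\<lambda>x. v x $ j) x"
    using weak_partial_uminus[OF assms(1,2) weak_partial_H1[OF H10_vec_component_H1[OF assms(3)]]]
    by (intro AE_finite_allI) auto
  then show ?thesis
    by eventually_elim (simp add: divergence_def sum_negf)
qed

lemma L2_inner_divergence_uminus:
  assumes "open \<Omega>" "bounded \<Omega>" "v \<in> H10_vec \<Omega>" "q \<in> L2 \<Omega>"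
  shows "L2_inner \<Omega> (divergence \<Omega> (\<lambda>x. - v x)) q = - L2_inner \<Omega> (divergence \<Omega> v) q"
proof -
  have "L2_inner \<Omega> (divergence \<Omega> (\<lambda>x. - v x)) q = L2_inner \<Omega> (\<lambda>x. - divergence \<Omega> v x) q"
    unfolding L2_inner_def
    using divergence_uminus[OF assms(1-3)] divergence_L2[OF assms(3)] assms(4)
      divergence_L2[OF H10_vec_uminus[OF assms(1-3)]]
    by (intro integral_cong_AE) (auto simp: L2_def elim: eventually_mono)
  then show ?thesis
    by (simp add: L2_inner_uminus_left)
qed

text \<open>Each of the \<open>CARD('d)\<close> diagonal derivatives is bounded by the full
  seminorm. A crude constant suffices: what matters is that it does not depend on
  \<open>v\<close>.\<close>

lemma divergence_bound:
  fixes v :: "real ^ 'd \<Rightarrow> real ^ 'd"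
  assumes "v \<in> H10_vec \<Omega>" "w \<in> L2 \<Omega>"
  shows "\<bar>L2_inner \<Omega> (divergence \<Omega> v) w\<bar> \<le> CARD('d) * H1_seminorm_vec \<Omega> v * L2_norm \<Omega> w"
proof -
  let ?D = "\<lambda>j k. weak_partial \<Omega> j (\<lambda>x. v x $ k)"
  have D: "?D j k \<in> L2 \<Omega>" for j k
    using weak_partial_H1(1)[OF H10_vec_component_H1[OF assms(1)]] .
  have le: "L2_norm \<Omega> (?D j j) \<le> H1_seminorm_vec \<Omega> v" for j
  proof -
    have "(L2_norm \<Omega> (?D j j))\<^sup>2 \<le> (\<Sum>i\<in>UNIV. (L2_norm \<Omega> (?D i j))\<^sup>2)"
      by (rule member_le_sum) auto
    also have "\<dots> \<le> (\<Sum>k\<in>UNIV. \<Sum>i\<in>UNIV. (L2_norm \<Omega> (?D i k))\<^sup>2)"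
      by (rule member_le_sum[where f = "\<lambda>k. \<Sum>i\<in>UNIV. (L2_norm \<Omega> (?D i k))\<^sup>2"]) (auto intro: sum_nonneg)
    finally show ?thesis
      unfolding H1_seminorm_vec_def by (rule real_le_rsqrt)
  qed
  have "L2_inner \<Omega> (divergence \<Omega> v) w = (\<Sum>j\<in>UNIV. L2_inner \<Omega> (?D j j) w)"
    unfolding L2_inner_def divergence_def sum_distrib_right
    using L2_mult_integrable[OF D assms(2)] by (intro Bochner_Integration.integral_sum) auto
  also have "\<bar>\<dots>\<bar> \<le> (\<Sum>j\<in>(UNIV::'d set). H1_seminorm_vec \<Omega> v * L2_norm \<Omega> w)"
  proof (rule order_trans[OF sum_abs sum_mono])
    fix j
    have "\<bar>L2_inner \<Omega> (?D j j) w\<bar> \<le> L2_norm \<Omega> (?D j j) * L2_norm \<Omega> w"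
      using D assms(2) by (rule L2_Cauchy_Schwarz_abs)
    also have "\<dots> \<le> H1_seminorm_vec \<Omega> v * L2_norm \<Omega> w"
      using le L2_norm_nonneg by (rule mult_right_mono)
    finally show "\<bar>L2_inner \<Omega> (?D j j) w\<bar> \<le> H1_seminorm_vec \<Omega> v * L2_norm \<Omega> w" .
  qed
  finally show ?thesis by (simp add: mult.assoc)
qed

subsection \<open>Upper semicontinuity of the inf-sup constants\<close>

text \<open>Split \<open>p = q + (p - q)\<close>. The seminorm in the bound for the second part
  cancels, so the error is independent of \<open>v\<close>; the ratio of norms accounts for the
  change of normalisation.\<close>

lemma quotient_perturbation:
  fixes v :: "real ^ 'd \<Rightarrow> real ^ 'd"
  assumes "v \<in> H10_vec \<Omega>" "p \<in> L2 \<Omega>" "q \<in> L2 \<Omega>" "0 < L2_norm \<Omega> p" "0 < L2_norm \<Omega> q"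
  shows "L2_inner \<Omega> (divergence \<Omega> v) p / (H1_seminorm_vec \<Omega> v * L2_norm \<Omega> p)
    \<le> L2_inner \<Omega> (divergence \<Omega> v) q / (H1_seminorm_vec \<Omega> v * L2_norm \<Omega> q) * (L2_norm \<Omega> q / L2_norm \<Omega> p)
      + CARD('d) * L2_norm \<Omega> (\<lambda>x. p x - q x) / L2_norm \<Omega> p"
proof (cases "H1_seminorm_vec \<Omega> v = 0")
  \<comment> \<open>Division by zero yields 0, so both quotients vanish and a nonnegative error term
    remains.\<close>
  case True
  then show ?thesis
    using L2_norm_nonneg[of \<Omega>] by simp
next
  case False
  let ?s = "H1_seminorm_vec \<Omega> v" and ?d = "\<lambda>x. p x - q x" and ?I = "L2_inner \<Omega> (divergence \<Omega> v)"
  have s: "0 < ?s"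
    using False H1_seminorm_vec_nonneg[of \<Omega> v] by simp
  have d: "?d \<in> L2 \<Omega>"
    using assms(2,3) by (rule L2_diff)
  have "?I p = ?I (\<lambda>x. q x + ?d x)" by simp
  also have "\<dots> = ?I q + ?I ?d"
    using divergence_L2[OF assms(1)] assms(3) d by (rule L2_inner_add_right)
  finally have "?I p \<le> ?I q + CARD('d) * ?s * L2_norm \<Omega> ?d"
    using divergence_bound[OF assms(1) d] by linarith
  then have "?I p / (?s * L2_norm \<Omega> p) \<le> (?I q + CARD('d) * ?s * L2_norm \<Omega> ?d) / (?s * L2_norm \<Omega> p)"
    using s assms(4) by (intro divide_right_mono) auto
  also have "\<dots> = ?I q / (?s * L2_norm \<Omega> q) * (L2_norm \<Omega> q / L2_norm \<Omega> p)
      + CARD('d) * L2_norm \<Omega> ?d / L2_norm \<Omega> p"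
    using s assms(4,5) by (simp add: add_divide_distrib)
  finally show ?thesis .
qed

text \<open>Nonemptiness matters here, because an empty supremum of extended reals would be
  \<open>-\<infinity>\<close>.\<close>

lemma SUP_quotient_nonneg:
  assumes "open \<Omega>" "bounded \<Omega>" "q \<in> L2 \<Omega>" "{v \<in> H10_vec \<Omega>. nonzero_on \<Omega> v} \<noteq> {}"
  shows "0 \<le> (SUP v \<in> {v \<in> H10_vec \<Omega>. nonzero_on \<Omega> v}.
    ereal (L2_inner \<Omega> (divergence \<Omega> v) q / (H1_seminorm_vec \<Omega> v * L2_norm \<Omega> q)))"
    (is "0 \<le> (SUP v \<in> ?V. ereal (?Q v))")
proof -
  obtain v where v: "v \<in> ?V" using assms(4) by blast
  have neg: "(\<lambda>x. - v x) \<in> ?V"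
    using v H10_vec_uminus[OF assms(1,2)] by (simp add: nonzero_on_def)
  have "?Q (\<lambda>x. - v x) = - ?Q v"
    using v by (simp add: L2_inner_divergence_uminus[OF assms(1,2) _ assms(3)]
        H1_seminorm_vec_uminus[OF assms(1,2)])
  then consider "0 \<le> ereal (?Q v)" | "0 \<le> ereal (?Q (\<lambda>x. - v x))"
    by (simp only: ereal_less_eq) linarith
  then show ?thesis
    by cases (rule SUP_upper2, rule v, assumption, rule SUP_upper2, rule neg, assumption)
qed

theorem theorem2p1:
  fixes \<Omega> :: "(real ^ 'd) set"
    and M :: "nat \<Rightarrow> (real ^ 'd \<Rightarrow> real) set"
    and X :: "nat \<Rightarrow> (real ^ 'd \<Rightarrow> real ^ 'd) set"
  assumes "domain \<Omega>" and "bounded \<Omega>"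
    and "\<And>n. closed_subspace (L2_mean_zero \<Omega>) (L2_norm \<Omega>) (M n)"
    and "\<And>n. closed_subspace (H10_vec \<Omega>) (H1_seminorm_vec \<Omega>) (X n)"
    and "\<And>q. q \<in> L2_mean_zero \<Omega> \<Longrightarrow>
           \<exists>Q :: nat \<Rightarrow> real ^ 'd \<Rightarrow> real. (\<forall>n. Q n \<in> M n) \<and>
             (\<lambda>n. L2_norm \<Omega> (\<lambda>x. Q n x - q x)) \<longlonglongrightarrow> 0"
  shows "limsup (\<lambda>n. infsup \<Omega> (M n) (X n)) \<le> LBB \<Omega>"
  unfolding LBB_def infsup_def[of _ "L2_mean_zero \<Omega>"]
proof (rule INF_greatest)
  fix q assume q: "q \<in> {q \<in> L2_mean_zero \<Omega>. nonzero_on \<Omega> q}"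
  let ?V = "{v \<in> H10_vec \<Omega>. nonzero_on \<Omega> v}"
  let ?Q = "\<lambda>q v. L2_inner \<Omega> (divergence \<Omega> v) q / (H1_seminorm_vec \<Omega> v * L2_norm \<Omega> q)"
  \<comment> \<open>\<open>S\<close> is the value that \<open>q\<close> contributes to the infimum
    defining \<open>LBB \<Omega>\<close>; it suffices to bound the limsup by it for each
    \<open>q\<close>.\<close>
  define S where "S = (if ?V = {} then 0 else SUP v \<in> ?V. ereal (?Q q v))"
  have "open \<Omega>"
    using assms(1) by (simp add: domain_def)
  have qL2: "q \<in> L2 \<Omega>"
    using q by (simp add: L2_mean_zero_def)
  have "0 \<le> S"
    using SUP_quotient_nonneg[OF \<open>open \<Omega>\<close> assms(2) qL2] by (simp add: S_def)
  obtain p where p: "\<And>n. p n \<in> M n" and lim: "(\<lambda>n. L2_norm \<Omega> (\<lambda>x. p n x - q x)) \<longlonglongrightarrow> 0"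
    using assms(5) q by blast
  have pL2: "p n \<in> L2 \<Omega>" for n
    using p[of n] assms(3)[of n] by (auto simp: closed_subspace_def L2_mean_zero_def)
  have q_pos: "0 < L2_norm \<Omega> q"
    using q L2_norm_eq_0_iff[OF qL2] L2_norm_nonneg[of \<Omega> q] by auto
  have norm_lim: "(\<lambda>n. L2_norm \<Omega> (p n)) \<longlonglongrightarrow> L2_norm \<Omega> q"
    using pL2 qL2 lim by (rule L2_norm_tendsto)
  have "limsup (\<lambda>n. infsup \<Omega> (M n) (X n)) \<le> S"
  \<comment> \<open>An infinite \<open>S\<close> bounds everything, and \<open>0 \<le> S\<close>
    excludes \<open>-\<infinity>\<close>.\<close>
  proof (cases S)
    case (real s)
    then have "0 \<le> s" using \<open>0 \<le> S\<close> by simp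
    \<comment> \<open>This is the right-hand side of \<open>quotient_perturbation\<close> for
      \<open>p n\<close>, with the quotient of \<open>q\<close> replaced by its upper bound
      \<open>s\<close>.\<close>
    let ?B = "\<lambda>n. s * (L2_norm \<Omega> q / L2_norm \<Omega> (p n))
      + CARD('d) * L2_norm \<Omega> (\<lambda>x. p n x - q x) / L2_norm \<Omega> (p n)"
    have bound: "infsup \<Omega> (M n) (X n) \<le> ereal (?B n)" if pos: "0 < L2_norm \<Omega> (p n)" for n
    proof -
      let ?X = "{v \<in> X n. nonzero_on \<Omega> v}"
      have "p n \<in> {q \<in> M n. nonzero_on \<Omega> q}"
        using p[of n] pos L2_norm_eq_0_iff[OF pL2[of n]] by auto
      then have "infsup \<Omega> (M n) (X n) \<le> (if ?X = {} then 0 else SUP v \<in> ?X. ereal (?Q (p n) v))"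
        unfolding infsup_def by (rule INF_lower)
      also have "\<dots> \<le> ereal (?B n)"
      proof (cases "?X = {}")
        \<comment> \<open>A trivial \<open>X n\<close> has the conventional value 0, which lies
          below the bound only because \<open>0 \<le> s\<close>.\<close>
        case True
        then show ?thesis
          using \<open>0 \<le> s\<close> pos L2_norm_nonneg[of \<Omega>] by simp
      next
        case False
        have "ereal (?Q (p n) v) \<le> ereal (?B n)" if v: "v \<in> ?X" for v
        proof -
          \<comment> \<open>As \<open>X n\<close> is contained in \<open>H10_vec \<Omega>\<close>,
            its velocities compete in the supremum \<open>S\<close>.\<close>
          have vV: "v \<in> ?V"
            using v assms(4)[of n] by (auto simp: closed_subspace_def)
          then have "ereal (?Q q v) \<le> S"
            unfolding S_def by (auto intro: SUP_upper)
          then have "?Q q v \<le> s"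
            by (simp add: real)
          then have "?Q q v * (L2_norm \<Omega> q / L2_norm \<Omega> (p n)) \<le> s * (L2_norm \<Omega> q / L2_norm \<Omega> (p n))"
            using pos q_pos by (intro mult_right_mono) auto
          with quotient_perturbation[OF _ pL2 qL2 pos q_pos, of v] vV show ?thesis
            by simp
        qed
        with False show ?thesis
          by (auto intro: SUP_least)
      qed
      finally show ?thesis .
    qed
    have "?B \<longlonglongrightarrow> s * (L2_norm \<Omega> q / L2_norm \<Omega> q) + CARD('d) * 0 / L2_norm \<Omega> q"
      using q_pos lim by (intro tendsto_intros norm_lim) auto
    then have "(\<lambda>n. ereal (?B n)) \<longlonglongrightarrow> ereal s"
      using q_pos by simp
    then have "limsup (\<lambda>n. ereal (?B n)) = ereal s"
      by (intro lim_imp_Limsup) auto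
    \<comment> \<open>The norms of \<open>p n\<close> tend to the positive norm of \<open>q\<close>,
      so \<open>p n\<close> is an admissible nonzero pressure for all large \<open>n\<close>, though
      possibly not for every \<open>n\<close>.\<close>
    moreover have "\<forall>\<^sub>F n in sequentially. infsup \<Omega> (M n) (X n) \<le> ereal (?B n)"
      using order_tendstoD(1)[OF norm_lim q_pos] by eventually_elim (rule bound)
    then have "limsup (\<lambda>n. infsup \<Omega> (M n) (X n)) \<le> limsup (\<lambda>n. ereal (?B n))"
      by (rule Limsup_mono)
    ultimately show ?thesis
      using real by simp
  qed (use \<open>0 \<le> S\<close> in auto)
  then show "limsup (\<lambda>n. infsup \<Omega> (M n) (X n))
      \<le> (if ?V = {} then 0 else SUP v \<in> ?V. ereal (?Q q v))"
    by (simp only: S_def)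
qed

end
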